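(* Let $K\ge2$. For $(\mathbf p,u)\in[0,1]^{K+1}$ define, with $\inf\varnothing=1$, $$F_{\mathrm{UA}}(\mathbf p,u)=\inf\left\{\alpha\in(0,1):\ \frac1K\sum_{k=1}^K \left(2-\frac{2p_k}\alpha\right)_+\ge u\right\},\qquad F'_{\mathrm{UA}}(\mathbf p,u)=\inf\left\{\alpha\in(0,1):\ \frac1K\sum_{k=1}^K\left(2-\frac{2p_k}\alpha\right)\ge u\right\},$$ and $F'_{\mathrm A}(\mathbf p)=2A(\mathbf p)$, seen as a randomized p-merging function whose value is not affected by $u$. The dominations among randomized p-merging functions $F_{\mathrm{UA}}\le F'_{\mathrm{UA}}\le F'_{\mathrm A}$ are strict. Moreover, $$F'_{\mathrm{UA}}(\mathbf p,u)=\frac{2A(\mathbf p)}{2-u},\qquad F_{\mathrm{UA}}(\mathbf p,u)=\left(\bigwedge_{m=1}^K\frac{2A(\mathbf p_{(m)})}{(2-Ku/m)_+}\right)\mathbf 1\{p_{(1)}>0\}.$$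
   Context: $\bigwedge$ denotes minimum; $x_+=\max(x,0)$; $\mathbf 1\{\cdot\}$ is the indicator; a fraction with denominator $0$ is read as $+\infty$. $A(\cdot)$ is the arithmetic mean of the components of a vector; $p_{(1)}=\min_ip_i$; $\mathbf p_{(m)}$ is the vector of the $m$ smallest elements of $\mathbf p$. Fix an atomless probability space (one supporting a random variable uniform on $[0,1]$); $\mathcal U$ is the set of random variables uniform on $[0,1]$, $\mathcal U^K$ the set of random vectors (arbitrary joint distribution) with all $K$ components in $\mathcal U$, and $\mathcal U^K\otimes\mathcal U$ the set of pairs $(\mathbf P,U)\in\mathcal U^K\times\mathcal U$ with $U$ independent of $\mathbf P$. A randomized p-merging function is an increasing (non-decreasing in each component) Borel function $F:[0,1]^{K+1}\to[0,1]$ with $\mathbb P(F(\mathbf P,U)\le\alpha)\le\alpha$ for all $\alpha\in(0,1)$ and all $(\mathbf P,U)\in\mathcal U^K\otimes\mathcal U$. $F$ dominates $G$ if $F\le G$ at every point, and the domination is strict if $F<G$ at at least one point.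
   Formalization: 2A(p), 2A(p)/(2-u) and the closed form of F_UA are truncated at 1, and the closed form of F_UA is asserted except where u=0 and p_(1)>0, or where p_(1)=0 and u>2#{k: p_k=0}/K; it is false at exactly those points. *)

theory Defs
  imports "HOL-Probability.Probability" "HOL-Library.Multiset"
begin

text \<open>A vector of \<open>K\<close> p-values is a \<open>p :: real ^ 'k\<close>, with \<open>K = CARD('k)\<close>. The order on
  \<open>real ^ 'k\<close> is componentwise, so \<open>{0..1} :: (real ^ 'k) set\<close> is the cube \<open>[0,1]^K\<close>.\<close>

definition uniform_rvs :: "'a measure \<Rightarrow> ('a \<Rightarrow> real) set" where
  "uniform_rvs M = {U \<in> borel_measurable M.
     (\<forall>\<omega>\<in>space M. U \<omega> \<in> {0..1}) \<and> distr M borel U = uniform_measure lborel {0..1}}"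
  (* Values in [0,1] are required surely, so that merging functions, defined on the cube
     only, can be evaluated at such variables without leaving their domain. *)

definition uniform_vecs :: "'a measure \<Rightarrow> ('a \<Rightarrow> real ^ 'k) set" where
  "uniform_vecs M = {P. \<forall>k. (\<lambda>\<omega>. P \<omega> $ k) \<in> uniform_rvs M}"

definition uniform_indep_pairs :: "'a measure \<Rightarrow> (('a \<Rightarrow> real ^ 'k) \<times> ('a \<Rightarrow> real)) set" where
  "uniform_indep_pairs M = {(P, U). P \<in> uniform_vecs M \<and> U \<in> uniform_rvs M \<and>
     prob_space.indep_set M (sets (vimage_algebra (space M) P borel))
       (sets (vimage_algebra (space M) U borel))}"
  (* indep_var needs both variables to have the same range type. *)

definition atomless_prob_space :: "'a measure \<Rightarrow> bool" where
  "atomless_prob_space M \<longleftrightarrow> prob_space M \<and> uniform_rvs M \<noteq> {}"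

definition randomized_p_merging :: "'a measure \<Rightarrow> (real ^ 'k \<Rightarrow> real \<Rightarrow> real) \<Rightarrow> bool" where
  "randomized_p_merging M F \<longleftrightarrow>
     (\<forall>p\<in>{0..1}. \<forall>u\<in>{0..1}. F p u \<in> {0..1}) \<and>
     (\<forall>p\<in>{0..1}. \<forall>q\<in>{0..1}. \<forall>u\<in>{0..1}. \<forall>v\<in>{0..1}. p \<le> q \<longrightarrow> u \<le> v \<longrightarrow> F p u \<le> F q v) \<and>
     (\<lambda>(p, u). F p u) \<in> borel_measurable (restrict_space borel ({0..1} \<times> {0..1})) \<and>
     (\<forall>\<alpha>\<in>{0<..<1}. \<forall>(P, U)\<in>uniform_indep_pairs M.
        measure M {\<omega>\<in>space M. F (P \<omega>) (U \<omega>) \<le> \<alpha>} \<le> \<alpha>)"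

definition dominates :: "(real ^ 'k \<Rightarrow> real \<Rightarrow> real) \<Rightarrow> (real ^ 'k \<Rightarrow> real \<Rightarrow> real) \<Rightarrow> bool" where
  "dominates F G \<longleftrightarrow> (\<forall>p\<in>{0..1}. \<forall>u\<in>{0..1}. F p u \<le> G p u)"

definition strictly_dominates ::
    "(real ^ 'k \<Rightarrow> real \<Rightarrow> real) \<Rightarrow> (real ^ 'k \<Rightarrow> real \<Rightarrow> real) \<Rightarrow> bool" where
  "strictly_dominates F G \<longleftrightarrow> dominates F G \<and> (\<exists>p\<in>{0..1}. \<exists>u\<in>{0..1}. F p u < G p u)"

definition mean_vec :: "real ^ 'k \<Rightarrow> real" where
  "mean_vec p = (\<Sum>k\<in>UNIV. p $ k) / real CARD('k)"

definition mean_list :: "real list \<Rightarrow> real" where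
  "mean_list xs = sum_list xs / real (length xs)"

definition min_vec :: "real ^ 'k \<Rightarrow> real" where
  "min_vec p = Min (range (\<lambda>k. p $ k))"

definition smallest :: "nat \<Rightarrow> real ^ 'k \<Rightarrow> real list" where
  "smallest m p = take m (sorted_list_of_multiset (image_mset (\<lambda>k. p $ k) (mset_set UNIV)))"

definition inf1 :: "real set \<Rightarrow> real" where
  "inf1 S = (if S = {} then 1 else Inf S)"

definition frac_inf :: "real \<Rightarrow> real \<Rightarrow> ereal" where
  "frac_inf a b = (if b = 0 then \<infinity> else ereal (a / b))"
  (* Not the division of ereal, for which 0 / 0 = 0. *)

definition F_UA :: "real ^ 'k \<Rightarrow> real \<Rightarrow> real" where
  "F_UA p u = inf1 {\<alpha>\<in>{0<..<1}.
     1 / real CARD('k) * (\<Sum>k\<in>UNIV. max (2 - 2 * p $ k / \<alpha>) 0) \<ge> u}"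

definition F'_UA :: "real ^ 'k \<Rightarrow> real \<Rightarrow> real" where
  "F'_UA p u = inf1 {\<alpha>\<in>{0<..<1}.
     1 / real CARD('k) * (\<Sum>k\<in>UNIV. 2 - 2 * p $ k / \<alpha>) \<ge> u}"

text \<open>Merging functions take values in \<open>[0,1]\<close>, so formulas for them are read up to
  truncation at \<open>1\<close>; \<open>2 A(p)\<close> itself can be as large as \<open>2\<close>.\<close>

definition F'_A :: "real ^ 'k \<Rightarrow> real \<Rightarrow> real" where
  "F'_A p u = min (2 * mean_vec p) 1"

definition UA_formula :: "real ^ 'k \<Rightarrow> real \<Rightarrow> ereal" where
  "UA_formula p u =
     (MIN m\<in>{1..CARD('k)}.
        frac_inf (2 * mean_list (smallest m p)) (max (2 - real CARD('k) * u / real m) 0))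
     * indicator {q. min_vec q > 0} p"

text \<open>The closed form of \<open>F_UA\<close> does not hold on a part of the boundary of the cube. If \<open>u = 0\<close>
  and all \<open>p\<^sub>k > 0\<close>, then \<open>F_UA p u = 0\<close>, whereas the formula gives the positive value
  \<open>min_vec p\<close>. If some \<open>p\<^sub>k\<close> are zero, then the formula gives \<open>0\<close>, whereas \<open>F_UA p u > 0\<close> as soon
  as the zero components alone do not reach the level \<open>u\<close>. Every pair in
  \<open>uniform_indep_pairs M\<close> avoids this exceptional set almost surely.\<close>

definition UA_exceptional :: "real ^ 'k \<Rightarrow> real \<Rightarrow> bool" where
  "UA_exceptional p u \<longleftrightarrow>
     min_vec p > 0 \<and> u = 0 \<or>
     min_vec p = 0 \<and> 2 * real (card {k. p $ k = 0}) / real CARD('k) < u"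

lemma UA_formula_fails:
  fixes p :: "real ^ 'k"
  assumes p: "p \<in> {0..1}" and u: "u \<in> {0..1}" and ex: "UA_exceptional p u"
  shows "ereal (F_UA p u) \<noteq> min (UA_formula p u) 1"
proof -
  have pk: "0 \<le> p $ k" for k using p by (auto simp: less_eq_vec_def)
  consider (a) "min_vec p > 0" "u = 0"
    | (b) "min_vec p = 0" "2 * real (card {k. p $ k = 0}) / real CARD('k) < u"
    using ex unfolding UA_exceptional_def by blast
  then show ?thesis
  proof cases
    case a
    have pos: "p $ k > 0" for k using a(1) unfolding min_vec_def
      by (meson Min_le finite finite_imageI less_le_trans rangeI)
    have "{\<alpha>\<in>{0<..<1}. 1 / real CARD('k) * (\<Sum>k\<in>UNIV. max (2 - 2 * p $ k / \<alpha>) 0) \<ge> u} = {0<..<1}"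
      unfolding a(2) by (auto intro!: divide_nonneg_nonneg sum_nonneg)
    hence "F_UA p u = Inf {0<..<1}" unfolding F_UA_def inf1_def by simp
    hence F: "F_UA p u = 0" by simp
    have "frac_inf (2 * mean_list (smallest m p)) (max (2 - real CARD('k) * u / real m) 0) > 0"
      if m: "m \<in> {1..CARD('k)}" for m
    proof -
      let ?l = "sorted_list_of_multiset (image_mset (\<lambda>k. p $ k) (mset_set UNIV))"
      have "mset ?l = image_mset (\<lambda>k. p $ k) (mset_set UNIV)" by simp
      hence len: "length ?l = CARD('k)" by (metis size_image_mset size_mset size_mset_set)
      have st: "set ?l = range (\<lambda>k. p $ k)" by simp
      have "\<forall>x\<in>set (smallest m p). x > 0" unfolding smallest_def
        using st pos by (metis in_set_takeD rangeE)
      moreover have ln: "length (smallest m p) = m" unfolding smallest_def using len m by simp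
      ultimately have "sum_list (smallest m p) > 0"
      proof (cases "smallest m p")
        case Nil thus ?thesis using ln m by auto
      next
        case (Cons x xs)
        assume "\<forall>x\<in>set (smallest m p). x > 0"
        thus ?thesis using Cons by (auto intro!: add_pos_nonneg sum_list_nonneg simp: less_imp_le)
      qed
      thus ?thesis using ln m a(2) by (auto simp: frac_inf_def mean_list_def)
    qed
    hence "UA_formula p u > 0" unfolding UA_formula_def using a(1)
      by (auto simp: Min_gr_iff)
    thus ?thesis using F by (auto simp: min_def zero_ereal_def)
  next
    case b
    define c where "c = Min (insert 1 ((\<lambda>k. p $ k) ` {k. p $ k > 0}))"
    have c0: "c > 0" unfolding c_def by auto
    have "\<alpha> \<ge> c" if al: "\<alpha> \<in> {0<..<1}"
      and g: "1 / real CARD('k) * (\<Sum>k\<in>UNIV. max (2 - 2 * p $ k / \<alpha>) 0) \<ge> u" for \<alpha>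
    proof (rule ccontr)
      assume n: "\<not> \<alpha> \<ge> c"
      have "max (2 - 2 * p $ k / \<alpha>) 0 = (if p $ k = 0 then 2 else 0)" for k
      proof (cases "p $ k = 0")
        case False
        hence "p $ k > 0" using pk[of k] by simp
        hence "c \<le> p $ k" unfolding c_def by (intro Min_le) auto
        thus ?thesis using n al False by (auto simp: field_simps max_def)
      qed auto
      hence "(\<Sum>k\<in>UNIV. max (2 - 2 * p $ k / \<alpha>) 0) = 2 * real (card {k. p $ k = 0})"
        by (simp add: sum.If_cases)
      thus False using g b(2) by simp
    qed
    hence "F_UA p u \<ge> min c 1" unfolding F_UA_def inf1_def
      by (auto intro!: cInf_greatest min.coboundedI1)
    hence "F_UA p u > 0" using c0 by linarith
    moreover have "UA_formula p u = 0" unfolding UA_formula_def using b(1) by simp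
    ultimately show ?thesis by (simp add: min_def zero_ereal_def)
  qed
qed

end

theory Submission
  imports Defs
begin

text \<open>The set whose infimum defines \<open>F_UA p u\<close> is upward closed in \<open>(0,1)\<close>, and by continuity
  \<open>F_UA p u \<le> \<alpha>\<close> forces \<open>u\<close> to be at most the average \<open>e\<close> of the terms \<open>(2 - 2 p\<^sub>k / \<alpha>)\<^sub>+\<close>.
  Conditioning on \<open>\<^bold>P\<close>, an independent uniform \<open>U\<close> lies below \<open>e\<close> with probability at most \<open>e\<close>,
  and each term has mean \<open>\<alpha>\<close> when \<open>P\<^sub>k\<close> is uniform; this bounds the error of \<open>F_UA\<close> and of
  everything above it. For the closed form, the sum of positive parts of a decreasing
  sequence is the largest of its partial sums, so \<open>u \<le> e\<close> splits into one linear inequality in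
  \<open>1 / \<alpha>\<close> for each number \<open>m\<close> of smallest components.\<close>

section \<open>The averaged calibrator and its monotonicity\<close>

text \<open>For \<alpha> in (0,1) each summand has mean \<alpha> when \<open>p $ k\<close> is
  uniform. Divided by \<alpha>, the average is therefore an e-value under any dependence between the
  components.\<close>

definition avg_calibrator :: "real \<Rightarrow> real ^ 'k \<Rightarrow> real" where
  "avg_calibrator \<alpha> p = 1 / real CARD('k) * (\<Sum>k\<in>UNIV. max (2 - 2 * p $ k / \<alpha>) 0)"

lemma F_UA_eq: "F_UA p u = inf1 {\<alpha>\<in>{0<..<1}. u \<le> avg_calibrator \<alpha> p}"
  unfolding F_UA_def avg_calibrator_def ..

lemma avg_calibrator_nonneg: "0 \<le> avg_calibrator \<alpha> p"
  unfolding avg_calibrator_def by (intro mult_nonneg_nonneg sum_nonneg) auto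

lemma avg_calibrator_mono:
  fixes p :: "real ^ 'k"
  assumes "0 \<le> p" "0 < \<alpha>" "\<alpha> \<le> \<beta>"
  shows "avg_calibrator \<alpha> p \<le> avg_calibrator \<beta> p"
proof -
  have "p $ k / \<beta> \<le> p $ k / \<alpha>" for k
    using assms by (intro divide_left_mono) (auto simp: less_eq_vec_def)
  then show ?thesis
    unfolding avg_calibrator_def times_divide_eq_right[symmetric]
    by (intro mult_left_mono sum_mono max.mono diff_left_mono) auto
qed

lemma avg_calibrator_antimono:
  fixes p :: "real ^ 'k"
  assumes "p \<le> q" "0 < \<alpha>"
  shows "avg_calibrator \<alpha> q \<le> avg_calibrator \<alpha> p"
  unfolding avg_calibrator_def using assms
  by (intro mult_left_mono sum_mono max.mono diff_left_mono divide_right_mono)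
     (auto simp: less_eq_vec_def)

lemma continuous_on_avg_calibrator: "continuous_on UNIV (avg_calibrator \<alpha>)"
  unfolding avg_calibrator_def[abs_def] divide_inverse by (intro continuous_intros)

lemma avg_calibrator_measurable [measurable]: "avg_calibrator \<alpha> \<in> borel_measurable borel"
  by (intro borel_measurable_continuous_onI continuous_on_avg_calibrator)

section \<open>Infima of subsets of the open unit interval\<close>

lemma inf1_lower:
  assumes "S \<subseteq> {0<..<1}" "\<alpha> \<in> S"
  shows "inf1 S \<le> \<alpha>"
proof -
  have "bdd_below S" using assms(1) by (intro bdd_belowI[of _ 0]) auto
  then have "Inf S \<le> \<alpha>" using assms(2) by (intro cInf_lower)
  then show ?thesis using assms(2) by (auto simp: inf1_def)
qed

lemma inf1_le_1:
  assumes "S \<subseteq> {0<..<1}"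
  shows "inf1 S \<le> 1"
proof (cases "S = {}")
  case False
  then obtain \<alpha> where "\<alpha> \<in> S" by blast
  then show ?thesis using inf1_lower[OF assms, of \<alpha>] assms by fastforce
qed (simp add: inf1_def)

lemma inf1_greatest:
  assumes "\<And>\<alpha>. \<alpha> \<in> S \<Longrightarrow> c \<le> \<alpha>" "c \<le> 1"
  shows "c \<le> inf1 S"
  using assms cInf_greatest[of S c] by (simp add: inf1_def)

lemma inf1_nonneg: "S \<subseteq> {0<..<1} \<Longrightarrow> 0 \<le> inf1 S"
  by (intro inf1_greatest) auto

text \<open>The default value 1 for an empty \<open>S\<close> does no harm, because
  \<open>inf1 T\<close> never exceeds 1.\<close>

lemma inf1_antimono:
  assumes "S \<subseteq> T" "T \<subseteq> {0<..<1}"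
  shows "inf1 T \<le> inf1 S"
  using assms inf1_le_1[of T] inf1_lower[of T] by (intro inf1_greatest) auto

lemma inf1_atLeast:
  assumes "0 \<le> c"
  shows "inf1 {\<alpha>\<in>{0<..<1}. c \<le> \<alpha>} = min c 1"
proof (cases "c < 1")
  case True
  \<comment> \<open>For \<open>c = 0\<close> the left endpoint is missing and the infimum 0 is not
    attained; for \<open>0 < c < 1\<close> it is a minimum.\<close>
  have "{\<alpha>\<in>{0<..<1}. c \<le> \<alpha>} = (if c = 0 then {0<..<1} else {c..<1})"
    using assms by auto
  then show ?thesis using True by (auto simp: inf1_def)
next
  case False
  then have "{\<alpha>\<in>{0<..<1}. c \<le> \<alpha>} = {}" by auto
  then show ?thesis using False unfolding inf1_def by simp
qed

section \<open>Range, sublevel sets and measurability of \<open>F_UA\<close>\<close>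

lemma F_UA_range: "F_UA p u \<in> {0..1}"
proof -
  have "{\<alpha>\<in>{0<..<1}. u \<le> avg_calibrator \<alpha> p} \<subseteq> {0<..<1}" by blast
  then show ?thesis unfolding F_UA_eq using inf1_le_1 inf1_nonneg by auto
qed

lemma F_UA_mono: "p \<le> q \<Longrightarrow> u \<le> v \<Longrightarrow> F_UA p u \<le> F_UA q v"
  unfolding F_UA_eq
  by (intro inf1_antimono) (auto dest: avg_calibrator_antimono)

text \<open>The defining set is upward closed in (0,1), so a witness below \<open>a\<close> can be
  raised to a rational one; this makes strict sublevel sets countable unions. Since
  \<open>a \<le> 1\<close>, every such \<open>r\<close> is an admissible level, and the default
  value 1 is never below \<open>a\<close>.\<close>

lemma F_UA_less_iff:
  fixes p :: "real ^ 'k"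
  assumes "0 \<le> p" "a \<le> 1"
  shows "F_UA p u < a \<longleftrightarrow> (\<exists>r\<in>\<rat>. 0 < r \<and> r < a \<and> u \<le> avg_calibrator r p)"
proof
  let ?S = "{\<alpha>\<in>{0<..<1}. u \<le> avg_calibrator \<alpha> p}"
  assume "F_UA p u < a"
  then have "?S \<noteq> {}" "Inf ?S < a" using assms(2) by (auto simp: F_UA_eq inf1_def split: if_splits)
  then obtain \<alpha> where \<alpha>: "\<alpha> \<in> ?S" "\<alpha> < a" using cInf_lessD[of ?S a] by blast
  then obtain r where "r \<in> \<rat>" "\<alpha> < r" "r < a" using Rats_dense_in_real by blast
  moreover then have "u \<le> avg_calibrator r p"
    using \<alpha> avg_calibrator_mono[OF assms(1), of \<alpha> r] by auto
  ultimately show "\<exists>r\<in>\<rat>. 0 < r \<and> r < a \<and> u \<le> avg_calibrator r p"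
    using \<alpha> by (intro bexI[of _ r]) auto
next
  assume "\<exists>r\<in>\<rat>. 0 < r \<and> r < a \<and> u \<le> avg_calibrator r p"
  then obtain r where r: "0 < r" "r < a" "u \<le> avg_calibrator r p" by auto
  let ?S = "{\<alpha>\<in>{0<..<1}. u \<le> avg_calibrator \<alpha> p}"
  have "F_UA p u \<le> r" unfolding F_UA_eq using r assms(2) by (intro inf1_lower) auto
  with r show "F_UA p u < a" by simp
qed

text \<open>The infimum only controls levels strictly above it: the inequality holds at every
  \<beta> in (\<alpha>,1). Letting \<beta> decrease to \<alpha> and using continuity in the level
  gives it at \<alpha> itself.\<close>

lemma F_UA_leD:
  fixes p :: "real ^ 'k"
  assumes "0 \<le> p" "\<alpha> \<in> {0<..<1}" "F_UA p u \<le> \<alpha>"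
  shows "u \<le> avg_calibrator \<alpha> p"
proof -
  have "u \<le> avg_calibrator \<beta> p" if \<beta>: "\<alpha> < \<beta>" "\<beta> < 1" for \<beta>
  proof -
    have "F_UA p u < \<beta>" using assms(3) \<beta> by simp
    then obtain r where "0 < r" "r < \<beta>" "u \<le> avg_calibrator r p"
      using F_UA_less_iff[OF assms(1), of \<beta> u] \<beta> by auto
    then show ?thesis using avg_calibrator_mono[OF assms(1), of r \<beta>] by auto
  qed
  then have "eventually (\<lambda>\<beta>. u \<le> avg_calibrator \<beta> p) (at_right \<alpha>)"
    using assms(2) by (auto simp: eventually_at_right[of \<alpha> 1])
  moreover have "((\<lambda>\<beta>. avg_calibrator \<beta> p) \<longlongrightarrow> avg_calibrator \<alpha> p) (at_right \<alpha>)"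
    unfolding avg_calibrator_def using assms(2) by (intro tendsto_intros) auto
  ultimately show ?thesis by (intro tendsto_lowerbound) auto
qed

lemma F_UA_measurable:
  "(\<lambda>(p :: real ^ 'k, u). F_UA p u) \<in> borel_measurable (restrict_space borel ({0..1} \<times> {0..1}))"
    (is "?F \<in> borel_measurable ?R")
proof -
  have sp: "space ?R = {0..1} \<times> {0..1}" by (simp add: space_restrict_space)
  \<comment> \<open>Continuity in \<open>p\<close> holds for every real \<open>r\<close>, even
    \<open>r = 0\<close>, where the quotient is constantly 0.\<close>
  have cl: "closed {x :: (real ^ 'k) \<times> real. snd x \<le> avg_calibrator r (fst x)}" for r
    by (intro closed_Collect_le continuous_intros
        continuous_on_compose2[OF continuous_on_avg_calibrator]) auto
  have st: "{x \<in> space ?R. snd x \<le> avg_calibrator r (fst x)} \<in> sets ?R" for r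
  proof -
    have "{x \<in> space ?R. snd x \<le> avg_calibrator r (fst x)} =
       ({0..1} \<times> {0..1}) \<inter> {x. snd x \<le> avg_calibrator r (fst x)}"
      unfolding sp by auto
    then show ?thesis unfolding sets_restrict_space using borel_closed[OF cl] by auto
  qed
  have "{x \<in> space ?R. ?F x < a} \<in> sets ?R" for a
  proof (cases "a \<le> 1")
    case True
    have "{x \<in> space ?R. ?F x < a} =
      (\<Union>r\<in>{r\<in>\<rat>. 0 < r \<and> r < a}. {x \<in> space ?R. snd x \<le> avg_calibrator r (fst x)})"
      using F_UA_less_iff[OF _ True] unfolding sp by (auto; blast)
    moreover have "countable {r\<in>\<rat>. 0 < r \<and> r < a}"
      by (rule countable_subset[OF _ countable_rat]) auto
    ultimately show ?thesis using st by (auto intro: sets.countable_UN')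
  next
    case False
    have "F_UA p u < a" for p :: "real ^ 'k" and u using F_UA_range[of p u] False by auto
    then have "{x \<in> space ?R. ?F x < a} = space ?R" by auto
    then show ?thesis by (metis sets.top)
  qed
  then show ?thesis by (simp add: borel_measurable_iff_less)
qed

section \<open>The error bound: means, independence and conditioning\<close>

lemma uniform_rvs_nn_integral:
  assumes "X \<in> uniform_rvs M" "f \<in> borel_measurable borel"
  shows "(\<integral>\<^sup>+\<omega>. f (X \<omega>) \<partial>M) = (\<integral>\<^sup>+x. f x * indicator {0..1} x \<partial>lborel)"
proof -
  have X: "X \<in> borel_measurable M" "distr M borel X = uniform_measure lborel {0..1}"
    using assms(1) by (auto simp: uniform_rvs_def)
  have "(\<integral>\<^sup>+\<omega>. f (X \<omega>) \<partial>M) = (\<integral>\<^sup>+x. f x \<partial>distr M borel X)"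
    using X(1) assms(2) by (simp add: nn_integral_distr)
  also have "\<dots> = (\<integral>\<^sup>+x. f x * indicator {0..1} x \<partial>lborel) / 1"
    using assms(2) by (simp add: X(2) nn_integral_uniform_measure)
  finally show ?thesis by (simp add: divide_ennreal_def)
qed

lemma nn_integral_calibrator:
  assumes X: "X \<in> uniform_rvs M" and \<alpha>: "\<alpha> \<in> {0<..<1}"
  shows "(\<integral>\<^sup>+\<omega>. ennreal (max (2 - 2 * X \<omega> / \<alpha>) 0) \<partial>M) = ennreal \<alpha>"
proof -
  have "(\<integral>\<^sup>+\<omega>. ennreal (max (2 - 2 * X \<omega> / \<alpha>) 0) \<partial>M)
      = (\<integral>\<^sup>+x. ennreal (max (2 - 2 * x / \<alpha>) 0) * indicator {0..1} x \<partial>lborel)"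
    by (rule uniform_rvs_nn_integral[OF X]) simp
  \<comment> \<open>The positive part vanishes beyond \<alpha>, which lies inside the unit interval,
    so a linear integrand on \<open>{0..\<alpha>}\<close> remains.\<close>
  also have "\<dots> = (\<integral>\<^sup>+x. ennreal (2 - 2 * x / \<alpha>) * indicator {0..\<alpha>} x \<partial>lborel)"
    using \<alpha> by (intro nn_integral_cong) (auto simp: indicator_def max_def field_simps ennreal_neg)
  also have "\<dots> = ennreal ((2 * \<alpha> - \<alpha>^2 / \<alpha>) - (2 * 0 - 0^2 / \<alpha>))"
    using \<alpha> by (intro nn_integral_FTC_Icc) (auto intro!: derivative_eq_intros simp: field_simps)
  also have "\<dots> = ennreal \<alpha>" using \<alpha> by (simp add: power2_eq_square)
  finally show ?thesis .
qed

text \<open>By independence the joint law is a product, so the event can be measured by fixing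
  \<open>X = x\<close> and integrating the probability that \<open>U \<le> x\<close>. That
  probability is at most \<open>x\<close>, with strict inequality once \<open>x > 1\<close>; the
  averaged calibrator can be as large as 2.\<close>

lemma (in prob_space) emeasure_le_indep_uniform:
  assumes U: "U \<in> uniform_rvs M" and ind: "indep_var borel X borel U"
    and nn: "\<And>\<omega>. \<omega> \<in> space M \<Longrightarrow> 0 \<le> X \<omega>"
  shows "emeasure M {\<omega>\<in>space M. U \<omega> \<le> X \<omega>} \<le> (\<integral>\<^sup>+\<omega>. ennreal (X \<omega>) \<partial>M)"
proof -
  have [measurable]: "random_variable borel X" "random_variable borel U"
    using ind indep_var_rv1 indep_var_rv2 by auto
  interpret U: prob_space "distr M borel U" by (rule prob_space_distr) simp
  let ?A = "{z :: real \<times> real. snd z \<le> fst z}"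
  have A: "?A \<in> sets (borel \<Otimes>\<^sub>M borel)"
    unfolding borel_prod by (intro borel_closed closed_Collect_le continuous_intros)
  \<comment> \<open>For negative \<open>x\<close> the event is null and \<open>ennreal x\<close> is
    0, so the bound holds on the whole line.\<close>
  have *: "emeasure (distr M borel U) {u. u \<le> x} \<le> ennreal x" for x
  proof (cases "0 \<le> x")
    case True
    have "emeasure (distr M borel U) {u. u \<le> x} = emeasure lborel ({0..1} \<inter> {u. u \<le> x})"
      using U by (auto simp: uniform_rvs_def divide_ennreal_def)
    also have "\<dots> \<le> emeasure lborel {0..x}" by (intro emeasure_mono) auto
    finally show ?thesis using True by simp
  next
    case False
    then have "{0..1} \<inter> {u. u \<le> x} = {}" by auto
    then show ?thesis using U by (auto simp: uniform_rvs_def)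
  qed
  have "emeasure M {\<omega>\<in>space M. U \<omega> \<le> X \<omega>}
      = emeasure (distr M (borel \<Otimes>\<^sub>M borel) (\<lambda>\<omega>. (X \<omega>, U \<omega>))) ?A"
    using A by (subst emeasure_distr) (auto intro!: arg_cong[where f = "emeasure M"])
  also have "\<dots> = emeasure (distr M borel X \<Otimes>\<^sub>M distr M borel U) ?A"
    using ind by (simp add: indep_var_distribution_eq)
  also have "\<dots> = (\<integral>\<^sup>+x. emeasure (distr M borel U) (Pair x -` ?A) \<partial>distr M borel X)"
    using A by (intro U.emeasure_pair_measure_alt) (simp cong: sets_pair_measure_cong)
  also have "\<dots> \<le> (\<integral>\<^sup>+x. ennreal x \<partial>distr M borel X)"
    using * by (intro nn_integral_mono) (simp add: vimage_def)
  also have "\<dots> = (\<integral>\<^sup>+\<omega>. ennreal (X \<omega>) \<partial>M)" by (simp add: nn_integral_distr)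
  finally show ?thesis .
qed

text \<open>A preimage under \<open>g\<close> after \<open>P\<close> is a preimage under
  \<open>P\<close>, so independence of the sigma-algebras of \<open>P\<close> and \<open>U\<close>
  is inherited. Composing with \<open>g\<close> also brings both variables to a common range type,
  as \<open>indep_var\<close> demands.\<close>

lemma (in prob_space) indep_var_compose_fst:
  assumes ind: "indep_set (sets (vimage_algebra (space M) P borel))
       (sets (vimage_algebra (space M) U borel))"
    and [measurable]: "g \<in> borel_measurable borel"
    and rv: "random_variable borel (\<lambda>\<omega>. g (P \<omega>))" "random_variable borel U"
  shows "indep_var borel (\<lambda>\<omega>. g (P \<omega>)) borel U"
proof -
  let ?\<sigma> = "\<lambda>X. sets (vimage_algebra (space M) X borel)"
  have "{(\<lambda>\<omega>. g (P \<omega>)) -` A \<inter> space M |A. A \<in> sets borel} \<subseteq> ?\<sigma> P"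
  proof safe
    fix A :: "'c set" assume "A \<in> sets borel"
    then have "g -` A \<in> sets borel" using measurable_sets[OF assms(2)] by simp
    then show "(\<lambda>\<omega>. g (P \<omega>)) -` A \<inter> space M \<in> ?\<sigma> P"
      using in_vimage_algebra[of "g -` A" borel P "space M"] by (simp add: vimage_def)
  qed
  moreover have "{U -` A \<inter> space M |A. A \<in> sets borel} \<subseteq> ?\<sigma> U"
    by (auto intro: in_vimage_algebra)
  ultimately have "indep_set {(\<lambda>\<omega>. g (P \<omega>)) -` A \<inter> space M |A. A \<in> sets borel}
      {U -` A \<inter> space M |A. A \<in> sets borel}"
    using ind unfolding indep_set_def
    by (elim indep_sets_mono_sets) (simp split: bool.split)
  \<comment> \<open>Stability under intersection lets independence pass from families of events to
    the sigma-algebras they generate.\<close>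
  moreover have Int_stable_preimages: "Int_stable {X -` A \<inter> space M |A. A \<in> sets N}"
    for X :: "'a \<Rightarrow> 'd" and N
  proof (rule Int_stableI)
    fix a b assume "a \<in> {X -` A \<inter> space M |A. A \<in> sets N}" "b \<in> {X -` A \<inter> space M |A. A \<in> sets N}"
    then obtain A B where "a \<inter> b = X -` (A \<inter> B) \<inter> space M" "A \<inter> B \<in> sets N" by blast
    then show "a \<inter> b \<in> {X -` A \<inter> space M |A. A \<in> sets N}" by blast
  qed
  ultimately have "indep_set (sigma_sets (space M) {(\<lambda>\<omega>. g (P \<omega>)) -` A \<inter> space M |A. A \<in> sets borel})
      (sigma_sets (space M) {U -` A \<inter> space M |A. A \<in> sets borel})"
    by (rule indep_set_sigma_sets)
       (intro Int_stable_preimages)+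
  then show ?thesis using rv by (simp add: indep_var_eq)
qed

text \<open>One bound serves all three functions: if \<open>G\<close> lies above \<open>F_UA\<close>
  on the cube, then \<open>G \<le> \<alpha>\<close> forces \<open>U\<close> below the averaged
  calibrator, whose mean is \<alpha>.\<close>

lemma (in prob_space) prob_le_of_F_UA_le:
  fixes P :: "'a \<Rightarrow> real ^ 'k"
  assumes PU: "(P, U) \<in> uniform_indep_pairs M" and \<alpha>: "\<alpha> \<in> {0<..<1}"
    and dom: "dominates F_UA G"
  shows "prob {\<omega>\<in>space M. G (P \<omega>) (U \<omega>) \<le> \<alpha>} \<le> \<alpha>"
proof -
  have Pk: "(\<lambda>\<omega>. P \<omega> $ k) \<in> uniform_rvs M" for k
    using PU by (auto simp: uniform_indep_pairs_def uniform_vecs_def)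
  have U: "U \<in> uniform_rvs M" using PU by (auto simp: uniform_indep_pairs_def)
  have [measurable]: "(\<lambda>\<omega>. P \<omega> $ k) \<in> borel_measurable M" for k
    using Pk[of k] by (simp add: uniform_rvs_def)
  have [measurable]: "random_variable borel U" using U by (simp add: uniform_rvs_def)
  have [measurable]: "random_variable borel (\<lambda>\<omega>. avg_calibrator \<alpha> (P \<omega>))"
    unfolding avg_calibrator_def by measurable
  have range: "P \<omega> \<in> {0..1}" "U \<omega> \<in> {0..1}" if "\<omega> \<in> space M" for \<omega>
    using Pk U that by (auto simp: uniform_rvs_def less_eq_vec_def)
  have ind: "indep_var borel (\<lambda>\<omega>. avg_calibrator \<alpha> (P \<omega>)) borel U"
    using PU by (intro indep_var_compose_fst) (auto simp: uniform_indep_pairs_def)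
  have "emeasure M {\<omega>\<in>space M. U \<omega> \<le> avg_calibrator \<alpha> (P \<omega>)}
      \<le> (\<integral>\<^sup>+\<omega>. ennreal (avg_calibrator \<alpha> (P \<omega>)) \<partial>M)"
    by (rule emeasure_le_indep_uniform[OF U ind avg_calibrator_nonneg])
  also have "\<dots> = (\<integral>\<^sup>+\<omega>. ennreal (1 / real CARD('k)) *
      (\<Sum>k\<in>UNIV. ennreal (max (2 - 2 * P \<omega> $ k / \<alpha>) 0)) \<partial>M)"
    unfolding avg_calibrator_def
    by (simp only: ennreal_mult' sum_ennreal max.cobounded2 divide_nonneg_nonneg zero_le_one of_nat_0_le_iff sum_nonneg)
  \<comment> \<open>Linearity uses only the marginal laws, so the joint law of the components is
    arbitrary.\<close>
  also have "\<dots> = ennreal (1 / real CARD('k)) * (\<Sum>k\<in>(UNIV :: 'k set). ennreal \<alpha>)"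
    by (simp add: nn_integral_cmult nn_integral_sum nn_integral_calibrator[OF Pk \<alpha>]
        del: sum_constant sum_ennreal ennreal_max_0 ennreal_max_0')
  also have "\<dots> = ennreal (1 / real CARD('k) * (\<Sum>k\<in>(UNIV :: 'k set). \<alpha>))"
    using \<alpha> by (subst sum_ennreal) (simp_all only: ennreal_mult' divide_nonneg_nonneg
        zero_le_one of_nat_0_le_iff greaterThanLessThan_iff less_imp_le)
  also have "\<dots> = ennreal \<alpha>" by simp
  finally have "prob {\<omega>\<in>space M. U \<omega> \<le> avg_calibrator \<alpha> (P \<omega>)} \<le> \<alpha>"
    using \<alpha> by (simp add: emeasure_eq_measure)
  \<comment> \<open>Monotonicity of the measure asks for measurability of the larger event
    alone.\<close>
  moreover have "prob {\<omega>\<in>space M. G (P \<omega>) (U \<omega>) \<le> \<alpha>}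
      \<le> prob {\<omega>\<in>space M. U \<omega> \<le> avg_calibrator \<alpha> (P \<omega>)}"
  proof (intro finite_measure_mono subsetI CollectI conjI)
    fix \<omega> assume \<omega>: "\<omega> \<in> {\<omega>\<in>space M. G (P \<omega>) (U \<omega>) \<le> \<alpha>}"
    then have "F_UA (P \<omega>) (U \<omega>) \<le> \<alpha>" using dom range unfolding dominates_def by fastforce
    then show "U \<omega> \<le> avg_calibrator \<alpha> (P \<omega>)" using F_UA_leD \<alpha> range \<omega> by force
  qed auto
  ultimately show ?thesis by linarith
qed

section \<open>The closed form of \<open>F'_UA\<close> and the pointwise comparisons\<close>

lemma mean_vec_mono: "p \<le> q \<Longrightarrow> mean_vec p \<le> mean_vec q"
  unfolding mean_vec_def by (intro divide_right_mono sum_mono) (auto simp: less_eq_vec_def)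

lemma mean_vec_nonneg: "0 \<le> p \<Longrightarrow> 0 \<le> mean_vec p"
  unfolding mean_vec_def by (intro divide_nonneg_nonneg sum_nonneg) (auto simp: less_eq_vec_def)

lemma mean_vec_measurable [measurable]: "mean_vec \<in> borel_measurable borel"
  unfolding mean_vec_def[abs_def] by measurable

lemma mean_calibrator_eq:
  fixes p :: "real ^ 'k"
  shows "1 / real CARD('k) * (\<Sum>k\<in>UNIV. 2 - 2 * p $ k / \<alpha>) = 2 - 2 * mean_vec p / \<alpha>"
  unfolding mean_vec_def
  by (simp add: sum_subtractf sum_distrib_left sum_divide_distrib[symmetric] right_diff_distrib)

text \<open>Without positive parts the constraint is linear in \<open>1 / \<alpha>\<close> and, as
  \<open>2 - u > 0\<close>, solves to a lower bound on \<alpha>. The truncation at 1 is the default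
  value of the infimum when no level is admissible.\<close>

lemma F'_UA_formula:
  fixes p :: "real ^ 'k"
  assumes "0 \<le> p" "u \<le> 1"
  shows "F'_UA p u = min (2 * mean_vec p / (2 - u)) 1"
proof -
  have *: "{\<alpha>\<in>{0<..<1}. u \<le> 2 - 2 * mean_vec p / \<alpha>}
      = {\<alpha>\<in>{0<..<1}. 2 * mean_vec p / (2 - u) \<le> \<alpha>}"
    using assms(2) by (auto simp: field_simps)
  have "0 \<le> 2 * mean_vec p / (2 - u)" using assms mean_vec_nonneg[of p] by simp
  then show ?thesis
    unfolding F'_UA_def mean_calibrator_eq * by (rule inf1_atLeast)
qed

lemma F_UA_le_F'_UA: "F_UA p u \<le> F'_UA p u"
proof -
  have "1 / real CARD('a) * (\<Sum>k\<in>UNIV. 2 - 2 * p $ k / \<alpha>) \<le> avg_calibrator \<alpha> p" for \<alpha>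
    unfolding avg_calibrator_def by (intro mult_left_mono sum_mono) auto
  then show ?thesis
    unfolding F_UA_eq F'_UA_def by (intro inf1_antimono) (auto intro: order_trans)
qed

lemma F'_UA_le_F'_A:
  assumes "0 \<le> p" "u \<le> 1"
  shows "F'_UA p u \<le> F'_A p u"
proof -
  have "2 * mean_vec p / (2 - u) \<le> 2 * mean_vec p / 1"
    using assms mean_vec_nonneg[of p] by (intro divide_left_mono) auto
  then show ?thesis using assms by (auto simp: F'_UA_formula F'_A_def)
qed

section \<open>The three functions as randomized p-merging functions\<close>

text \<open>Domination by \<open>F_UA\<close> supplies the error condition, leaving range,
  monotonicity and measurability to be checked for each function.\<close>

lemma randomized_p_mergingI:
  fixes G :: "real ^ 'k \<Rightarrow> real \<Rightarrow> real"
  assumes "prob_space M"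
    and "\<And>p u. p \<in> {0..1} \<Longrightarrow> u \<in> {0..1} \<Longrightarrow> G p u \<in> {0..1}"
    and "\<And>p q u v. p \<in> {0..1} \<Longrightarrow> q \<in> {0..1} \<Longrightarrow> u \<in> {0..1} \<Longrightarrow> v \<in> {0..1} \<Longrightarrow>
      p \<le> q \<Longrightarrow> u \<le> v \<Longrightarrow> G p u \<le> G q v"
    and "(\<lambda>(p, u). G p u) \<in> borel_measurable (restrict_space borel ({0..1} \<times> {0..1}))"
    and "dominates F_UA G"
  shows "randomized_p_merging M G"
  unfolding randomized_p_merging_def
proof (intro conjI ballI impI)
  show "case x of (P, U) \<Rightarrow> Sigma_Algebra.measure M {\<omega> \<in> space M. G (P \<omega>) (U \<omega>) \<le> \<alpha>} \<le> \<alpha>"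
    if "\<alpha> \<in> {0<..<1}" "x \<in> uniform_indep_pairs M" for \<alpha> x
    using prob_space.prob_le_of_F_UA_le[OF assms(1) _ that(1) assms(5)] that(2)
    by (cases x) simp
qed (fact assms(2-4))+

lemma randomized_p_merging_F_UA:
  assumes "prob_space M"
  shows "randomized_p_merging M (F_UA :: real ^ 'k \<Rightarrow> real \<Rightarrow> real)"
proof (rule randomized_p_mergingI[OF assms])
  show "F_UA p u \<in> {0..1}" for p :: "real ^ 'k" and u
    by (rule F_UA_range)
  show "F_UA p u \<le> F_UA q v" if "p \<le> q" "u \<le> v" for p q :: "real ^ 'k" and u v
    using that by (rule F_UA_mono)
qed (rule F_UA_measurable, simp add: dominates_def)

lemma randomized_p_merging_F'_UA:
  assumes "prob_space M"
  shows "randomized_p_merging M (F'_UA :: real ^ 'k \<Rightarrow> real \<Rightarrow> real)"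
proof (rule randomized_p_mergingI[OF assms])
  show "F'_UA p u \<in> {0..1}" if "p \<in> {0..1}" "u \<in> {0..1}" for p :: "real ^ 'k" and u
    using that mean_vec_nonneg[of p] by (auto simp: F'_UA_formula)
  show "F'_UA p u \<le> F'_UA q v"
    if "p \<in> {0..1}" "q \<in> {0..1}" "u \<in> {0..1}" "v \<in> {0..1}" "p \<le> q" "u \<le> v"
    for p q :: "real ^ 'k" and u v
  proof -
    have "2 * mean_vec p / (2 - u) \<le> 2 * mean_vec q / (2 - v)"
      using that mean_vec_mono[of p q] mean_vec_nonneg[of p] by (intro frac_le) auto
    then show ?thesis using that by (auto simp: F'_UA_formula)
  qed
  let ?R = "restrict_space (borel :: ((real ^ 'k) \<times> real) measure) ({0..1} \<times> {0..1})"
  have "(\<lambda>(p, u). min (2 * mean_vec p / (2 - u)) 1) \<in> borel_measurable (borel :: ((real ^ 'k) \<times> real) measure)"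
    unfolding borel_prod[symmetric] by measurable
  then have "(\<lambda>(p, u). min (2 * mean_vec p / (2 - u)) 1) \<in> borel_measurable ?R"
    by (rule measurable_restrict_space1)
  \<comment> \<open>The closed form is available on the cube, so measurability is transferred by
    congruence on the restricted space.\<close>
  then show "(\<lambda>(p, u). F'_UA p u) \<in> borel_measurable ?R"
    by (rule measurable_cong[THEN iffD1, rotated]) (auto simp: space_restrict_space F'_UA_formula)
qed (simp add: dominates_def F_UA_le_F'_UA)

lemma randomized_p_merging_F'_A:
  assumes "prob_space M"
  shows "randomized_p_merging M (F'_A :: real ^ 'k \<Rightarrow> real \<Rightarrow> real)"
proof (rule randomized_p_mergingI[OF assms])
  show "F'_A p u \<in> {0..1}" if "p \<in> {0..1}" for p :: "real ^ 'k" and u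
    using that mean_vec_nonneg[of p] by (auto simp: F'_A_def)
  show "F'_A p u \<le> F'_A q v" if "p \<le> q" for p q :: "real ^ 'k" and u v
    using mean_vec_mono[OF that] by (auto simp: F'_A_def)
  have "(\<lambda>(p, u). F'_A p u) \<in> borel_measurable (borel :: ((real ^ 'k) \<times> real) measure)"
    unfolding borel_prod[symmetric] F'_A_def by measurable
  then show "(\<lambda>(p, u). F'_A p u) \<in> borel_measurable
      (restrict_space (borel :: ((real ^ 'k) \<times> real) measure) ({0..1} \<times> {0..1}))"
    by (rule measurable_restrict_space1)
  show "dominates F_UA (F'_A :: real ^ 'k \<Rightarrow> real \<Rightarrow> real)"
    unfolding dominates_def using order_trans[OF F_UA_le_F'_UA F'_UA_le_F'_A] by auto
qed

section \<open>Zero components and strictness of the dominations\<close>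

text \<open>A zero component contributes 2 whatever the level, and every other one at least
  0.\<close>

lemma avg_calibrator_ge_zeros:
  fixes p :: "real ^ 'k"
  shows "2 * real (card {k. p $ k = 0}) / real CARD('k) \<le> avg_calibrator \<alpha> p"
proof -
  have "2 * real (card {k. p $ k = 0}) = (\<Sum>k\<in>UNIV. if p $ k = 0 then 2 else 0)"
    by (simp add: sum.If_cases)
  also have "\<dots> \<le> (\<Sum>k\<in>UNIV. max (2 - 2 * p $ k / \<alpha>) 0)" by (intro sum_mono) auto
  finally show ?thesis unfolding avg_calibrator_def by (simp add: divide_right_mono)
qed

text \<open>When the zeros alone reach \<open>u\<close>, every level in (0,1) is admissible.\<close>

lemma F_UA_eq_0:
  fixes p :: "real ^ 'k"
  assumes "u \<le> 2 * real (card {k. p $ k = 0}) / real CARD('k)"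
  shows "F_UA p u = 0"
proof -
  have "{\<alpha>\<in>{0<..<1}. u \<le> avg_calibrator \<alpha> p} = {0<..<1}"
    using assms avg_calibrator_ge_zeros[of p] by (auto intro: order_trans)
  then show ?thesis by (simp add: F_UA_eq inf1_def)
qed

lemma strictly_dominates_F_UA_F'_UA:
  assumes "CARD('k) \<ge> 2"
  shows "strictly_dominates (F_UA :: real ^ 'k \<Rightarrow> real \<Rightarrow> real) F'_UA"
proof -
  obtain j :: 'k where True by simp
  \<comment> \<open>All entries but one vanish, and \<open>2 * (K - 1) / K \<ge> 1\<close> for
    \<open>K \<ge> 2\<close>, so the zeros reach \<open>u = 1\<close>; the entry 1 keeps the mean
    positive.\<close>
  define p :: "real ^ 'k" where "p = axis j 1"
  have p: "p \<in> {0..1}" by (auto simp: p_def axis_def less_eq_vec_def)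
  have "{k. p $ k = 0} = UNIV - {j}" by (auto simp: p_def axis_def)
  then have "card {k. p $ k = 0} = CARD('k) - 1" by (simp add: card_Diff_singleton)
  then have "F_UA p 1 = 0" using assms by (intro F_UA_eq_0) (simp add: field_simps)
  moreover have "mean_vec p > 0" by (simp add: mean_vec_def p_def axis_def)
  then have "F'_UA p 1 > 0" using p by (simp add: F'_UA_formula)
  ultimately show ?thesis using p F_UA_le_F'_UA
    unfolding strictly_dominates_def dominates_def by (intro conjI ballI bexI[of _ p] bexI[of _ 1]) auto
qed

lemma strictly_dominates_F'_UA_F'_A:
  "strictly_dominates (F'_UA :: real ^ 'k \<Rightarrow> real \<Rightarrow> real) F'_A"
proof -
  \<comment> \<open>At \<open>u = 0\<close> the values are 1/4 and 1/2; both stay below the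
    truncation at 1, which would otherwise hide the gap.\<close>
  define p :: "real ^ 'k" where "p = (\<chi> k. 1 / 4)"
  have p: "p \<in> {0..1}" by (auto simp: p_def less_eq_vec_def)
  have "mean_vec p = 1 / 4" by (simp add: mean_vec_def p_def)
  then have "F'_UA p 0 < F'_A p 0" using p by (simp add: F'_UA_formula F'_A_def)
  then show ?thesis using p F'_UA_le_F'_A
    unfolding strictly_dominates_def dominates_def by (intro conjI ballI bexI[of _ p] bexI[of _ 0]) auto
qed

section \<open>Sums of positive parts as maximal partial sums\<close>

lemma sum_list_take_le_sum_list_max:
  fixes f :: "'a \<Rightarrow> real"
  shows "sum_list (map f (take m xs)) \<le> sum_list (map (\<lambda>x. max (f x) 0) xs)"
proof (induction xs arbitrary: m)
  case (Cons x xs)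
  show ?case
  proof (cases m)
    case 0
    then show ?thesis by (auto intro!: add_nonneg_nonneg sum_list_nonneg)
  next
    case (Suc n)
    then show ?thesis using Cons[of n] by (simp add: max_def)
  qed
qed simp

text \<open>Along a sorted list an antitone \<open>f\<close> is positive first and nonpositive
  afterwards; cutting where the sign changes keeps exactly the positive terms. The cut is at 0 if
  there are none.\<close>

lemma ex_sum_list_take_eq_sum_list_max:
  fixes f :: "'a :: linorder \<Rightarrow> real"
  assumes "antimono f" "sorted xs"
  shows "\<exists>m\<le>length xs. sum_list (map f (take m xs)) = sum_list (map (\<lambda>x. max (f x) 0) xs)"
  using assms(2)
proof (induction xs)
  case (Cons x xs)
  show ?case
  proof (cases "f x \<le> 0")
    case True
    have "f y \<le> 0" if "y \<in> set xs" for y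
      using Cons.prems that True antimonoD[OF assms(1), of x y] by auto
    then have "map (\<lambda>x. max (f x) 0) xs = map (\<lambda>x. 0) xs" by auto
    then have "sum_list (map (\<lambda>x. max (f x) 0) xs) = 0" by (simp only: sum_list_0)
    then show ?thesis using True by (intro exI[of _ 0]) simp
  next
    case False
    obtain m where "m \<le> length xs"
      "sum_list (map f (take m xs)) = sum_list (map (\<lambda>x. max (f x) 0) xs)"
      using Cons by auto
    then show ?thesis using False by (intro exI[of _ "Suc m"]) auto
  qed
qed simp

lemma sum_list_calibrator:
  fixes xs :: "real list"
  shows "sum_list (map (\<lambda>x. 2 - 2 * x / \<alpha>) xs) = 2 * real (length xs) - 2 * sum_list xs / \<alpha>"
  by (induction xs) (auto simp: field_simps add_divide_distrib)

section \<open>The closed form of \<open>F_UA\<close>\<close>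

definition sorted_entries :: "real ^ 'k \<Rightarrow> real list" where
  "sorted_entries p = sorted_list_of_multiset (image_mset (\<lambda>k. p $ k) (mset_set UNIV))"

lemma smallest_eq: "smallest m p = take m (sorted_entries p)"
  by (simp add: smallest_def sorted_entries_def)

lemma mset_sorted_entries: "mset (sorted_entries p) = image_mset (\<lambda>k. p $ k) (mset_set UNIV)"
  by (simp add: sorted_entries_def)

lemma length_sorted_entries: "length (sorted_entries (p :: real ^ 'k)) = CARD('k)"
  by (metis mset_sorted_entries size_image_mset size_mset size_mset_set)

lemma avg_calibrator_sorted_entries:
  fixes p :: "real ^ 'k"
  shows "avg_calibrator \<alpha> p =
    sum_list (map (\<lambda>x. max (2 - 2 * x / \<alpha>) 0) (sorted_entries p)) / real CARD('k)"
proof -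
  have "sum_list (map (\<lambda>x. max (2 - 2 * x / \<alpha>) 0) (sorted_entries p))
      = (\<Sum>k\<in>UNIV. max (2 - 2 * p $ k / \<alpha>) 0)"
    by (simp add: sum_mset_sum_list[symmetric] mset_sorted_entries sum_unfold_sum_mset
        image_mset.compositionality o_def)
  then show ?thesis by (simp add: avg_calibrator_def)
qed

text \<open>The averaged calibrator is the largest partial sum over the sorted entries, divided by
  \<open>K\<close>. Reaching \<open>u\<close> thus means that some prefix of length \<open>m\<close>
  does, and each such condition is solved for \<alpha>.\<close>

lemma le_avg_calibrator_iff:
  fixes p :: "real ^ 'k"
  assumes u: "0 < u" and \<alpha>: "0 < \<alpha>" and pos: "\<And>k. 0 < p $ k"
  shows "u \<le> avg_calibrator \<alpha> p \<longleftrightarrow> (\<exists>m\<in>{1..CARD('k)}.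
    frac_inf (2 * mean_list (smallest m p)) (max (2 - real CARD('k) * u / real m) 0) \<le> ereal \<alpha>)"
    (is "_ \<longleftrightarrow> (\<exists>m\<in>_. ?c m \<le> _)")
proof -
  let ?xs = "sorted_entries p" and ?K = "real CARD('k)" and ?f = "\<lambda>x. 2 - 2 * x / \<alpha>"
  have set: "set ?xs = range (\<lambda>k. p $ k)" by (simp add: sorted_entries_def)
  have "antimono ?f" using \<alpha> by (auto intro!: antimonoI divide_right_mono)
  moreover have "sorted ?xs" by (simp add: sorted_entries_def)
  ultimately obtain m0 where m0: "m0 \<le> CARD('k)"
    "sum_list (map ?f (take m0 ?xs)) = sum_list (map (\<lambda>x. max (?f x) 0) ?xs)"
    using ex_sum_list_take_eq_sum_list_max[of ?f ?xs] by (auto simp: length_sorted_entries)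
  have "u \<le> avg_calibrator \<alpha> p \<longleftrightarrow> ?K * u \<le> sum_list (map (\<lambda>x. max (?f x) 0) ?xs)"
    by (simp add: avg_calibrator_sorted_entries field_simps)
  also have "\<dots> \<longleftrightarrow> (\<exists>m\<in>{1..CARD('k)}. ?K * u \<le> sum_list (map ?f (take m ?xs)))"
  proof
    assume *: "?K * u \<le> sum_list (map (\<lambda>x. max (?f x) 0) ?xs)"
    \<comment> \<open>Positivity of \<open>u\<close> rules out the empty prefix, which has no
      counterpart among the fractions.\<close>
    have "0 < ?K * u" using u by simp
    with * have "0 < sum_list (map ?f (take m0 ?xs))" using m0(2) by linarith
    then have "m0 \<noteq> 0" by (intro notI) simp
    with * m0 show "\<exists>m\<in>{1..CARD('k)}. ?K * u \<le> sum_list (map ?f (take m ?xs))"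
      by (intro bexI[of _ m0]) auto
  next
    assume "\<exists>m\<in>{1..CARD('k)}. ?K * u \<le> sum_list (map ?f (take m ?xs))"
    then show "?K * u \<le> sum_list (map (\<lambda>x. max (?f x) 0) ?xs)"
      using sum_list_take_le_sum_list_max[of ?f _ ?xs] order_trans by blast
  qed
  also have "\<dots> \<longleftrightarrow> (\<exists>m\<in>{1..CARD('k)}. ?c m \<le> ereal \<alpha>)"
  proof (intro bex_cong refl)
    fix m assume m: "m \<in> {1..CARD('k)}"
    define s where "s = sum_list (take m ?xs)"
    have len: "length (take m ?xs) = m" using m by (simp add: length_sorted_entries)
    have "\<forall>x\<in>set (take m ?xs). 0 < x" using set pos by (metis in_set_takeD rangeE)
    moreover have "take m ?xs \<noteq> []" using len m by auto
    ultimately have s: "0 < s" unfolding s_def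
      by (cases "take m ?xs") (auto intro!: add_pos_nonneg sum_list_nonneg simp: less_imp_le)
    have "?K * u \<le> sum_list (map ?f (take m ?xs)) \<longleftrightarrow> ?K * u \<le> 2 * real m - 2 * s / \<alpha>"
      using len by (simp only: sum_list_calibrator s_def)
    also have "\<dots> \<longleftrightarrow> 2 * s \<le> \<alpha> * (2 * real m - ?K * u)"
      using \<alpha> by (auto simp: field_simps)
    also have "\<dots> \<longleftrightarrow> ?c m \<le> ereal \<alpha>"
    proof (cases "0 < 2 * real m - ?K * u")
      case True
      then have "0 < 2 - ?K * u / real m" using m by (simp add: field_simps)
      then show ?thesis using m True len
        by (simp add: frac_inf_def smallest_eq mean_list_def s_def[symmetric] max_def field_simps)
    next
      case False
      \<comment> \<open>Here the truncated denominator is 0 and the fraction is infinite; the linear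
        inequality fails as well because \<open>s > 0\<close>.\<close>
      then have "\<alpha> * (2 * real m - ?K * u) \<le> 0" using \<alpha> by (simp add: mult_le_0_iff)
      moreover have "2 - ?K * u / real m \<le> 0" using False m by (simp add: field_simps)
      ultimately show ?thesis using s by (simp add: frac_inf_def max_def)
    qed
    finally show "?K * u \<le> sum_list (map ?f (take m ?xs)) \<longleftrightarrow> ?c m \<le> ereal \<alpha>" .
  qed
  finally show ?thesis .
qed

text \<open>An infinite bound \<open>c\<close> leaves no admissible level, and the default value 1
  agrees with the truncation.\<close>

lemma ereal_inf1_atLeast:
  assumes "0 \<le> c"
  shows "ereal (inf1 {\<alpha>\<in>{0<..<1}. c \<le> ereal \<alpha>}) = min c 1"
proof (cases c)
  case (real r)
  then show ?thesis using assms inf1_atLeast[of r]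
    by (simp add: one_ereal_def del: ereal_min) (simp add: min_def)
qed (use assms in \<open>auto simp: inf1_def one_ereal_def\<close>)

text \<open>Outside the exceptional set two cases remain: a zero minimum, where the zeros reach
  \<open>u\<close> and both sides are 0, and a positive minimum with \<open>u > 0\<close>, where the
  prefix criterion applies.\<close>

lemma F_UA_formula:
  fixes p :: "real ^ 'k"
  assumes p: "p \<in> {0..1}" and u: "u \<in> {0..1}" and ex: "\<not> UA_exceptional p u"
  shows "ereal (F_UA p u) = min (UA_formula p u) 1"
proof -
  have p0: "0 \<le> p $ k" for k using p by (auto simp: less_eq_vec_def)
  then have min0: "0 \<le> min_vec p" by (simp add: min_vec_def)
  show ?thesis
  proof (cases "min_vec p = 0")
    case True
    then have "u \<le> 2 * real (card {k. p $ k = 0}) / real CARD('k)"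
      using ex by (auto simp: UA_exceptional_def)
    \<comment> \<open>The indicator is 0, and in \<open>ereal\<close> it annihilates even an
      infinite minimum.\<close>
    then show ?thesis using True by (simp add: F_UA_eq_0 UA_formula_def zero_ereal_def[symmetric])
  next
    case False
    then have min_pos: "0 < min_vec p" using min0 by simp
    then have u0: "0 < u" using ex u by (auto simp: UA_exceptional_def)
    have pos: "0 < p $ k" for k using min_pos by (simp add: min_vec_def)
    let ?c = "\<lambda>m. frac_inf (2 * mean_list (smallest m p)) (max (2 - real CARD('k) * u / real m) 0)"
    let ?C = "MIN m\<in>{1..CARD('k)}. ?c m"
    have "0 \<le> mean_list (smallest m p)" for m
    proof -
      have "\<forall>x\<in>set (smallest m p). 0 \<le> x"
        unfolding smallest_eq using p0 by (auto simp: sorted_entries_def dest!: in_set_takeD)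
      then show ?thesis by (simp add: mean_list_def sum_list_nonneg)
    qed
    then have "0 \<le> ?c m" for m by (simp add: frac_inf_def)
    then have "0 \<le> ?C" by (subst Min_ge_iff) (auto simp: Suc_le_eq)
    \<comment> \<open>A finite minimum is at most \<alpha> exactly when one of its terms is, which
      merges the conditions for all \<open>m\<close> into a single threshold.\<close>
    moreover have "F_UA p u = inf1 {\<alpha>\<in>{0<..<1}. ?C \<le> ereal \<alpha>}"
    proof -
      have "u \<le> avg_calibrator \<alpha> p \<longleftrightarrow> ?C \<le> ereal \<alpha>" if "\<alpha> \<in> {0<..<1}" for \<alpha>
      proof -
        have "?C \<le> ereal \<alpha> \<longleftrightarrow> (\<exists>m\<in>{1..CARD('k)}. ?c m \<le> ereal \<alpha>)"
          by (subst Min_le_iff) (auto simp: Suc_le_eq)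
        then show ?thesis using le_avg_calibrator_iff[OF u0 _ pos] that by simp
      qed
      then show ?thesis unfolding F_UA_eq by (metis (no_types, lifting))
    qed
    ultimately have "ereal (F_UA p u) = min ?C 1" using ereal_inf1_atLeast by simp
    then show ?thesis using min_pos by (simp add: UA_formula_def)
  qed
qed

theorem theorem6p3:
  fixes M :: "'a measure"
  assumes "atomless_prob_space M"
    and "CARD('k::finite) \<ge> 2"
  shows "randomized_p_merging M (F_UA :: real ^ 'k \<Rightarrow> real \<Rightarrow> real)
    \<and> randomized_p_merging M (F'_UA :: real ^ 'k \<Rightarrow> real \<Rightarrow> real)
    \<and> randomized_p_merging M (F'_A :: real ^ 'k \<Rightarrow> real \<Rightarrow> real)
    \<and> strictly_dominates (F_UA :: real ^ 'k \<Rightarrow> real \<Rightarrow> real) F'_UA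
    \<and> strictly_dominates (F'_UA :: real ^ 'k \<Rightarrow> real \<Rightarrow> real) F'_A
    \<and> (\<forall>p\<in>{0..1 :: real ^ 'k}. \<forall>u\<in>{0..1}. F'_UA p u = min (2 * mean_vec p / (2 - u)) 1)
    \<and> (\<forall>p\<in>{0..1 :: real ^ 'k}. \<forall>u\<in>{0..1}. \<not> UA_exceptional p u \<longrightarrow>
         ereal (F_UA p u) = min (UA_formula p u) 1)"
proof -
  have M: "prob_space M" using assms(1) by (simp add: atomless_prob_space_def)
  show ?thesis
  proof (intro conjI ballI impI)
    show "F'_UA p u = min (2 * mean_vec p / (2 - u)) 1"
      if "p \<in> {0..1}" "u \<in> {0..1}" for p :: "real ^ 'k" and u
      using that by (simp add: F'_UA_formula)
  qed (rule randomized_p_merging_F_UA[OF M] randomized_p_merging_F'_UA[OF M]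
      randomized_p_merging_F'_A[OF M] strictly_dominates_F_UA_F'_UA[OF assms(2)]
      strictly_dominates_F'_UA_F'_A F_UA_formula; assumption)+
qed

end
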